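(* Let $\mathbf{x}\in L^2(\mathbb{R})$, let $k\in\mathbb{Q}^+$ and let $\theta\in\mathbb{R}$ with $\theta\notin\pi\mathbb{Z}$. Then for $\tau,u\in\mathbb{R}$: (i) $\overline{\mathcal{A}^{\theta,k}_{\mathbf{x}}(\tau,u)}=\mathcal{A}^{\theta,k}_{\mathbf{x}}(-\tau,-u)$; (ii) $\mathcal{A}^{\theta,k}_{P\mathbf{x}}(\tau,u)=\mathcal{A}^{\theta,k}_{\mathbf{x}}(-\tau,-u)$, where $(P\mathbf{x})(t)=\mathbf{x}(-t)$.
   Context: Superscript $*$ and the overline both denote complex conjugation. $\Omega_\theta=\sqrt{(1-i\cot\theta)/2\pi}$, so $|\Omega_\theta|^2=|\csc\theta|/(2\pi)$. The new fractional ambiguity function (NFrAF) of $\mathbf{x}\in L^2(\mathbb{R})$ with parameters $(\theta,k)$ is $$\mathcal{A}^{\theta,k}_{\mathbf{x}}(\tau,u)=|\Omega_\theta|^2\int_{\mathbb{R}}\mathbf{x}\left(t+k\tfrac{\tau}{2}\right)\mathbf{x}^*\left(t-k\tfrac{\tau}{2}\right)e^{it(k\tau\cot\theta-u\csc\theta)}\,dt.$$ *)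

theory Defs
  imports "HOL-Analysis.Analysis"
begin

text \<open>Elements of \<open>L\<^sup>2(\<real>)\<close> are represented by functions, not by
  almost-everywhere classes.\<close>

definition L2_real :: "(real \<Rightarrow> complex) set" where
  "L2_real = {x. x \<in> borel_measurable lebesgue \<and> integrable lebesgue (\<lambda>t. (cmod (x t))\<^sup>2)}"

definition csc :: "real \<Rightarrow> real" where
  "csc \<theta> = 1 / sin \<theta>"

definition Omega :: "real \<Rightarrow> complex" where
  "Omega \<theta> = csqrt ((1 - \<i> * complex_of_real (cot \<theta>)) / complex_of_real (2 * pi))"

lemma cmod_Omega_square:
  assumes "sin \<theta> \<noteq> 0"
  shows "(cmod (Omega \<theta>))\<^sup>2 = \<bar>csc \<theta>\<bar> / (2 * pi)"
proof -
  have "cmod (1 - \<i> * complex_of_real (cot \<theta>)) = sqrt (1 + (cot \<theta>)\<^sup>2)"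
    by (simp add: cmod_def)
  also have "1 + (cot \<theta>)\<^sup>2 = (csc \<theta>)\<^sup>2"
    using assms sin_cos_squared_add[of \<theta>]
    by (simp add: cot_def csc_def power_divide field_simps)
  finally have *: "cmod (1 - \<i> * complex_of_real (cot \<theta>)) = \<bar>csc \<theta>\<bar>"
    by simp
  have "(cmod (Omega \<theta>))\<^sup>2 = cmod ((Omega \<theta>)\<^sup>2)"
    by (simp add: norm_power)
  also have "\<dots> = cmod ((1 - \<i> * complex_of_real (cot \<theta>)) / complex_of_real (2 * pi))"
    by (simp only: Omega_def power2_csqrt)
  also have "\<dots> = \<bar>csc \<theta>\<bar> / (2 * pi)"
    using * by (simp add: norm_divide norm_mult)
  finally show ?thesis .
qed

definition NFrAF :: "real \<Rightarrow> real \<Rightarrow> (real \<Rightarrow> complex) \<Rightarrow> real \<Rightarrow> real \<Rightarrow> complex" where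
  "NFrAF \<theta> k x \<tau> u =
     complex_of_real ((cmod (Omega \<theta>))\<^sup>2) *
     (LINT t|lebesgue. x (t + k * (\<tau> / 2)) * cnj (x (t - k * (\<tau> / 2))) *
        exp (\<i> * complex_of_real (t * (k * \<tau> * cot \<theta> - u * csc \<theta>))))"

definition reflect :: "(real \<Rightarrow> complex) \<Rightarrow> real \<Rightarrow> complex" where
  "reflect x t = x (- t)"

end

theory Submission
  imports Defs
begin

text \<open>Put \<open>a = k * (\<tau> / 2)\<close> and \<open>\<omega> = k * \<tau> * cot \<theta> - u * csc \<theta>\<close>. Replacing \<open>(\<tau>, u)\<close>
  by \<open>(-\<tau>, -u)\<close> negates both \<open>a\<close> and \<open>\<omega>\<close>, and so does complex conjugation of the integrand
  \<open>x (t + a) * cnj (x (t - a)) * exp (\<i> * (t * \<omega>))\<close>; since conjugation commutes with the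
  integral and the prefactor is real, (i) follows. For (ii), the substitution \<open>t \<mapsto> -t\<close> in the
  integral for the reflected signal produces the same sign changes, and Lebesgue measure is
  invariant under this reflection (\<open>lebesgue_integral_reflect\<close>).\<close>

lemma distr_lebesgue_uminus: "distr lebesgue lebesgue (uminus :: real \<Rightarrow> real) = lebesgue"
  using lebesgue_real_affine[of "-1" 0] by (simp add: density_1)

text \<open>No measurability of \<open>f\<close> is required: if \<open>f\<close> is not integrable, then neither is its
  reflection, and both Bochner integrals take the default value \<open>0\<close>.\<close>

lemma lebesgue_integral_reflect:
  fixes f :: "real \<Rightarrow> 'a :: {banach, second_countable_topology}"
  shows "(LINT t|lebesgue. f (- t)) = (LINT t|lebesgue. f t)"
proof -
  have meas: "(uminus :: real \<Rightarrow> real) \<in> lebesgue \<rightarrow>\<^sub>M lebesgue"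
    using lebesgue_affine_measurable[of "\<lambda>_. -1" "0 :: real"] by simp
  have eq: "(LINT t|lebesgue. g (- t)) = (LINT t|lebesgue. g t)"
    if "g \<in> borel_measurable lebesgue" for g :: "real \<Rightarrow> 'a"
    using integral_distr[OF meas that] by (simp add: distr_lebesgue_uminus)
  show ?thesis
  proof (cases "f \<in> borel_measurable lebesgue")
    case True
    then show ?thesis by (rule eq)
  next
    case False
    have "(\<lambda>t. f (- t)) \<notin> borel_measurable lebesgue"
    proof
      assume "(\<lambda>t. f (- t)) \<in> borel_measurable lebesgue"
      from measurable_compose[OF meas this] False show False by simp
    qed
    with False show ?thesis
      by (metis borel_measurable_integrable not_integrable_integral_eq)
  qed
qed

lemma cnj_NFrAF: "cnj (NFrAF \<theta> k x \<tau> u) = NFrAF \<theta> k x (- \<tau>) (- u)"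
proof -
  have "cnj (x (t + k * (\<tau> / 2)) * cnj (x (t - k * (\<tau> / 2))) *
          exp (\<i> * complex_of_real (t * (k * \<tau> * cot \<theta> - u * csc \<theta>)))) =
        x (t + k * (- \<tau> / 2)) * cnj (x (t - k * (- \<tau> / 2))) *
          exp (\<i> * complex_of_real (t * (k * (- \<tau>) * cot \<theta> - (- u) * csc \<theta>)))" for t
    by (simp add: exp_cnj algebra_simps)
  then show ?thesis
    unfolding NFrAF_def complex_cnj_mult[of "complex_of_real _"] complex_cnj_complex_of_real
      Bochner_Integration.integral_cnj[symmetric]
    by (simp only:)
qed

lemma NFrAF_reflect: "NFrAF \<theta> k (reflect x) \<tau> u = NFrAF \<theta> k x (- \<tau>) (- u)"
proof -
  define F where "F t = x (t + k * (- \<tau> / 2)) * cnj (x (t - k * (- \<tau> / 2))) *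
    exp (\<i> * complex_of_real (t * (k * (- \<tau>) * cot \<theta> - (- u) * csc \<theta>)))" for t
  have "reflect x (t + k * (\<tau> / 2)) * cnj (reflect x (t - k * (\<tau> / 2))) *
      exp (\<i> * complex_of_real (t * (k * \<tau> * cot \<theta> - u * csc \<theta>))) = F (- t)" for t
    by (simp add: F_def reflect_def algebra_simps)
  then show ?thesis
    using lebesgue_integral_reflect[of F] by (simp add: NFrAF_def F_def)
qed

theorem mainTheorem5:
  fixes x :: "real \<Rightarrow> complex" and k \<theta> \<tau> u :: real
  assumes "x \<in> L2_real"
    and "k \<in> \<rat>" and "k > 0"
    and "\<theta> \<notin> range (\<lambda>m :: int. of_int m * pi)"
  shows "cnj (NFrAF \<theta> k x \<tau> u) = NFrAF \<theta> k x (- \<tau>) (- u) \<and>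
    NFrAF \<theta> k (reflect x) \<tau> u = NFrAF \<theta> k x (- \<tau>) (- u)"
  using cnj_NFrAF NFrAF_reflect by blast

end
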